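(* Every spiny symmetric set of degree at most $2$ is $2$-coskeletal.
   Context: Let $\Upsilon$ be the category with objects $[n]=\{0,1,\dots,n\}$, $n\ge 0$, and all functions as morphisms. A symmetric set is a functor $X\colon \Upsilon^{\mathrm{op}}\to\mathsf{Set}$; write $X_n$ for its value on $[n]$ and $\alpha^*\colon X_n\to X_m$ for the action of $\alpha\colon[m]\to[n]$. Let $\epsilon_{ij}\colon[1]\to[n]$ be the map $0\mapsto i$, $1\mapsto j$. For $n\ge 1$, the Segal map is $\mathscr{E}_n\colon X_n\to X_1^{\times n}$, $x\mapsto(\epsilon_{01}^*x,\epsilon_{12}^*x,\dots,\epsilon_{n-1,n}^*x)$, and the Bousfield–Segal map is $\mathscr{B}_n\colon X_n\to X_1^{\times n}$, $x\mapsto(\epsilon_{01}^*x,\epsilon_{02}^*x,\dots,\epsilon_{0n}^*x)$. A symmetric set is spiny if $\mathscr{E}_n$ is injective for all $n\ge1$; equivalently $\mathscr{B}_n$ is injective for all $n\ge 1$. The starry word complex $\mathbf{S}X$ has $\mathbf{S}X_0=X_0$ and, for $n\ge1$, $\mathbf{S}X_n=\{(f_1,\dots,f_n)\in X_1^{\times n}\mid f_1,\dots,f_n \text{ have the same source}\}$, where the source of $f\in X_1$ is $d_1f\in X_0$, the restriction along $[0]\to[1]$, $0\mapsto 0$. For $n\ge 2$ and $1\le i\le n$, $d_i\colon\mathbf{S}X_n\to\mathbf{S}X_{n-1}$ deletes the entry $f_i$. The map $\mathscr{B}_n$ takes values in $\mathbf{S}X_n$. A spiny symmetric set $X$ has degree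 at most $k$ (for $k\ge1$) if for each $n\ge k+1$, whenever $w\in\mathbf{S}X_n$ satisfies $d_{n-k}w,\dots,d_nw\in\mathscr{B}_{n-1}(X_{n-1})$, then $w\in\mathscr{B}_n(X_n)$. The $n$-skeleton $\mathrm{sk}_nX$ is the smallest symmetric subset of $X$ containing all $k$-simplices for $k\le n$. The functor $\mathrm{sk}_n$ on symmetric sets has a right adjoint $\mathrm{cosk}_n$ (equivalently: restrict to the full subcategory $\Upsilon_{\le n}$ on $[0],\dots,[n]$ and then right Kan extend). $X$ is $n$-coskeletal if the canonical map $X\to\mathrm{cosk}_nX$ is an isomorphism. *)

theory Defs
  imports Complex_Main "HOL-Library.FuncSet"
begin

section \<open>Symmetric sets\<close>

text \<open>
  The object \<open>[n]\<close> is \<open>{..n}\<close>. Morphisms are extensional functions, so that equality of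
  morphisms is equality of HOL terms; identities are \<open>restrict id\<close>, and \<open>\<alpha>\<close> after \<open>\<beta>\<close> is
  \<open>compose {..k} \<alpha> \<beta>\<close>, where \<open>[k]\<close> is the domain of \<open>\<beta>\<close>.
\<close>

definition maps :: "nat \<Rightarrow> nat \<Rightarrow> (nat \<Rightarrow> nat) set" where
  "maps m n = {..m} \<rightarrow>\<^sub>E {..n}"

text \<open>
  \<open>Act X m n \<alpha>\<close> is \<open>\<alpha>\<^sup>* : X\<^sub>n \<rightarrow> X\<^sub>m\<close> for \<open>\<alpha> : [m] \<rightarrow> [n]\<close>. The degrees are arguments because
  the sets \<open>Simp X n\<close> need not be disjoint.
\<close>

record 'a symset =
  Simp :: "nat \<Rightarrow> 'a set"
  Act :: "nat \<Rightarrow> nat \<Rightarrow> (nat \<Rightarrow> nat) \<Rightarrow> 'a \<Rightarrow> 'a"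

locale symmetric_set =
  fixes X :: "'a symset"
  assumes Act_closed:
      "\<lbrakk>\<alpha> \<in> maps m n; x \<in> Simp X n\<rbrakk> \<Longrightarrow> Act X m n \<alpha> x \<in> Simp X m"
    and Act_id: "x \<in> Simp X n \<Longrightarrow> Act X n n (restrict id {..n}) x = x"
    and Act_comp:
      "\<lbrakk>\<beta> \<in> maps k m; \<alpha> \<in> maps m n; x \<in> Simp X n\<rbrakk>
        \<Longrightarrow> Act X k n (compose {..k} \<alpha> \<beta>) x = Act X k m \<beta> (Act X m n \<alpha> x)"

text \<open>
  Natural transformations between the restrictions of \<open>X\<close> and \<open>Y\<close> to the full subcategory on the
  objects \<open>[k]\<close> with \<open>k \<in> L\<close>; \<open>L = UNIV\<close> gives the morphisms of symmetric sets.
\<close>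

definition nat_trans :: "nat set \<Rightarrow> 'a symset \<Rightarrow> 'b symset \<Rightarrow> (nat \<Rightarrow> 'a \<Rightarrow> 'b) set" where
  "nat_trans L X Y =
     {f \<in> (\<Pi>\<^sub>E k\<in>L. Simp X k \<rightarrow>\<^sub>E Simp Y k).
        \<forall>k\<in>L. \<forall>l\<in>L. \<forall>\<alpha>\<in>maps k l. \<forall>x\<in>Simp X l.
          f k (Act X k l \<alpha> x) = Act Y k l \<alpha> (f l x)}"

definition symset_iso :: "'a symset \<Rightarrow> 'b symset \<Rightarrow> (nat \<Rightarrow> 'a \<Rightarrow> 'b) \<Rightarrow> bool" where
  "symset_iso X Y f \<longleftrightarrow>
     f \<in> nat_trans UNIV X Y \<and>
     (\<exists>g \<in> nat_trans UNIV Y X.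
        (\<forall>n. \<forall>x\<in>Simp X n. g n (f n x) = x) \<and>
        (\<forall>n. \<forall>y\<in>Simp Y n. f n (g n y) = y))"

section \<open>Spiny symmetric sets and degree\<close>

text \<open>The map \<open>\<epsilon>\<^sub>i\<^sub>j : [1] \<rightarrow> [n]\<close>; as an extensional function it does not depend on \<open>n\<close>.\<close>

definition eps :: "nat \<Rightarrow> nat \<Rightarrow> nat \<Rightarrow> nat" where
  "eps i j = (\<lambda>t\<in>{..1}. if t = 0 then i else j)"

text \<open>Elements of \<open>X\<^sub>1\<^sup>n\<close> are lists of length \<open>n\<close>; the entry \<open>f\<^sub>i\<close> has list index \<open>i - 1\<close>.\<close>

definition segal :: "'a symset \<Rightarrow> nat \<Rightarrow> 'a \<Rightarrow> 'a list" where
  "segal X n x = map (\<lambda>i. Act X 1 n (eps i (i + 1)) x) [0..<n]"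

definition bousfield :: "'a symset \<Rightarrow> nat \<Rightarrow> 'a \<Rightarrow> 'a list" where
  "bousfield X n x = map (\<lambda>i. Act X 1 n (eps 0 i) x) [1..<n + 1]"

definition spiny :: "'a symset \<Rightarrow> bool" where
  "spiny X \<longleftrightarrow> (\<forall>n\<ge>1. inj_on (segal X n) (Simp X n))"

definition source :: "'a symset \<Rightarrow> 'a \<Rightarrow> 'a" where
  "source X f = Act X 0 1 (\<lambda>t\<in>{..0}. 0) f"

text \<open>
  The starry word complex in positive degrees. Its degree \<open>0\<close> part is not needed: the degree
  condition below only involves degrees \<open>n\<close> and \<open>n - 1\<close> with \<open>n \<ge> 2\<close>.
\<close>

definition starry :: "'a symset \<Rightarrow> nat \<Rightarrow> 'a list set" where
  "starry X n =
     {w. length w = n \<and> set w \<subseteq> Simp X 1 \<and> (\<forall>f\<in>set w. \<forall>g\<in>set w. source X f = source X g)}"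

text \<open>The face \<open>d\<^sub>i\<close>, for \<open>1 \<le> i \<le> length w\<close>: delete the \<open>i\<close>-th entry, counting from \<open>1\<close>.\<close>

definition face :: "nat \<Rightarrow> 'a list \<Rightarrow> 'a list" where
  "face i w = take (i - 1) w @ drop i w"

text \<open>Only meaningful for \<open>k \<ge> 1\<close>.\<close>

definition degree_at_most :: "nat \<Rightarrow> 'a symset \<Rightarrow> bool" where
  "degree_at_most k X \<longleftrightarrow>
     (\<forall>n\<ge>k + 1. \<forall>w\<in>starry X n.
        (\<forall>i\<in>{n - k..n}. face i w \<in> bousfield X (n - 1) ` Simp X (n - 1)) \<longrightarrow>
        w \<in> bousfield X n ` Simp X n)"

section \<open>Coskeleta\<close>

text \<open>
  \<open>cosk n X\<close> is the right Kan extension of the restriction of \<open>X\<close> to the objects \<open>[k]\<close> with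
  \<open>k \<le> n\<close>, given by the pointwise formula: its \<open>m\<close>-simplices are the compatible families
  \<open>s(k, \<alpha>) \<in> X\<^sub>k\<close> indexed by all \<open>\<alpha> : [k] \<rightarrow> [m]\<close> with \<open>k \<le> n\<close>. Its universal property is
  \<open>bij_betw_cosk_transpose\<close> below.
\<close>

definition cosk_index :: "nat \<Rightarrow> nat \<Rightarrow> (nat \<times> (nat \<Rightarrow> nat)) set" where
  "cosk_index n m = (SIGMA k:{..n}. maps k m)"

definition cosk :: "nat \<Rightarrow> 'a symset \<Rightarrow> (nat \<times> (nat \<Rightarrow> nat) \<Rightarrow> 'a) symset" where
  "cosk n X =
     \<lparr>Simp = (\<lambda>m. {s \<in> (\<Pi>\<^sub>E (k, \<alpha>)\<in>cosk_index n m. Simp X k).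
        \<forall>k\<le>n. \<forall>l\<le>n. \<forall>\<beta>\<in>maps k l. \<forall>\<alpha>\<in>maps l m.
          s (k, compose {..k} \<alpha> \<beta>) = Act X k l \<beta> (s (l, \<alpha>))}),
      Act = (\<lambda>p m \<gamma> s. \<lambda>(k, \<alpha>)\<in>cosk_index n p. s (k, compose {..k} \<gamma> \<alpha>))\<rparr>"

definition cosk_transpose ::
    "nat \<Rightarrow> 'b symset \<Rightarrow> (nat \<Rightarrow> 'b \<Rightarrow> 'a) \<Rightarrow> nat \<Rightarrow> 'b \<Rightarrow> nat \<times> (nat \<Rightarrow> nat) \<Rightarrow> 'a" where
  "cosk_transpose n Y f =
     (\<lambda>m. \<lambda>y\<in>Simp Y m. \<lambda>(k, \<alpha>)\<in>cosk_index n m. f k (Act Y k m \<alpha> y))"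

text \<open>The canonical map \<open>X \<rightarrow> cosk n X\<close>, the transpose of the identity.\<close>

definition cosk_unit :: "nat \<Rightarrow> 'a symset \<Rightarrow> nat \<Rightarrow> 'a \<Rightarrow> nat \<times> (nat \<Rightarrow> nat) \<Rightarrow> 'a" where
  "cosk_unit n X = (\<lambda>m. \<lambda>x\<in>Simp X m. \<lambda>(k, \<alpha>)\<in>cosk_index n m. Act X k m \<alpha> x)"

definition coskeletal :: "nat \<Rightarrow> 'a symset \<Rightarrow> bool" where
  "coskeletal n X \<longleftrightarrow> symset_iso X (cosk n X) (cosk_unit n X)"

subsection \<open>The universal property\<close>

lemma maps_id: "restrict id {..n} \<in> maps n n"
  by (auto simp: maps_def)

lemma maps_compose: "\<beta> \<in> maps k m \<Longrightarrow> \<alpha> \<in> maps m n \<Longrightarrow> compose {..k} \<alpha> \<beta> \<in> maps k n"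
  by (auto simp: maps_def compose_def PiE_iff)

lemma compose_id_left: "\<alpha> \<in> maps m n \<Longrightarrow> compose {..m} (restrict id {..n}) \<alpha> = \<alpha>"
  by (rule ext) (auto simp: maps_def compose_def PiE_iff extensional_def)

lemma compose_id_right: "\<alpha> \<in> maps m n \<Longrightarrow> compose {..m} \<alpha> (restrict id {..m}) = \<alpha>"
  by (rule ext) (auto simp: maps_def compose_def PiE_iff extensional_def)

lemma maps_compose_assoc:
  "\<gamma> \<in> maps j k \<Longrightarrow>
     compose {..j} (compose {..k} \<alpha> \<beta>) \<gamma> = compose {..j} \<alpha> (compose {..j} \<beta> \<gamma>)"
  by (rule ext) (auto simp: maps_def compose_def PiE_iff)

lemma cosk_Act:
  "(k, \<alpha>) \<in> cosk_index n p \<Longrightarrow> Act (cosk n X) p m \<gamma> s (k, \<alpha>) = s (k, compose {..k} \<gamma> \<alpha>)"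
  by (simp add: cosk_def)

lemma cosk_SimpI:
  assumes "s \<in> extensional (cosk_index n m)"
    and "\<And>k \<alpha>. k \<le> n \<Longrightarrow> \<alpha> \<in> maps k m \<Longrightarrow> s (k, \<alpha>) \<in> Simp X k"
    and "\<And>k l \<alpha> \<beta>. k \<le> n \<Longrightarrow> l \<le> n \<Longrightarrow> \<beta> \<in> maps k l \<Longrightarrow> \<alpha> \<in> maps l m \<Longrightarrow>
      s (k, compose {..k} \<alpha> \<beta>) = Act X k l \<beta> (s (l, \<alpha>))"
  shows "s \<in> Simp (cosk n X) m"
  using assms by (auto simp: cosk_def PiE_iff cosk_index_def)

lemma cosk_SimpD:
  assumes "s \<in> Simp (cosk n X) m"
  shows "s \<in> extensional (cosk_index n m)"
    and "\<And>k \<alpha>. k \<le> n \<Longrightarrow> \<alpha> \<in> maps k m \<Longrightarrow> s (k, \<alpha>) \<in> Simp X k"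
    and "\<And>k l \<alpha> \<beta>. k \<le> n \<Longrightarrow> l \<le> n \<Longrightarrow> \<beta> \<in> maps k l \<Longrightarrow> \<alpha> \<in> maps l m \<Longrightarrow>
      s (k, compose {..k} \<alpha> \<beta>) = Act X k l \<beta> (s (l, \<alpha>))"
  using assms by (auto simp: cosk_def PiE_iff cosk_index_def)

lemma cosk_Act_extensional: "Act (cosk n X) p m \<gamma> s \<in> extensional (cosk_index n p)"
  by (simp add: cosk_def)

lemma cosk_Act_closed:
  assumes "\<gamma> \<in> maps p m" "s \<in> Simp (cosk n X) m"
  shows "Act (cosk n X) p m \<gamma> s \<in> Simp (cosk n X) p"
proof (rule cosk_SimpI)
  show "Act (cosk n X) p m \<gamma> s \<in> extensional (cosk_index n p)"
    by (rule cosk_Act_extensional)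
next
  fix k \<alpha> assume "k \<le> n" "\<alpha> \<in> maps k p"
  then show "Act (cosk n X) p m \<gamma> s (k, \<alpha>) \<in> Simp X k"
    using cosk_SimpD(2)[OF assms(2)] maps_compose[OF _ assms(1)]
    by (simp add: cosk_Act cosk_index_def)
next
  fix k l \<alpha> \<beta> assume *: "k \<le> n" "l \<le> n" "\<beta> \<in> maps k l" "\<alpha> \<in> maps l p"
  have "compose {..k} \<gamma> (compose {..k} \<alpha> \<beta>) = compose {..k} (compose {..l} \<gamma> \<alpha>) \<beta>"
    using maps_compose_assoc[OF *(3)] by metis
  then show "Act (cosk n X) p m \<gamma> s (k, compose {..k} \<alpha> \<beta>) =
      Act X k l \<beta> (Act (cosk n X) p m \<gamma> s (l, \<alpha>))"
    using * cosk_SimpD(3)[OF assms(2) *(1-3) maps_compose[OF *(4) assms(1)]]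
    by (simp add: cosk_Act cosk_index_def maps_compose)
qed

lemma symmetric_set_cosk: "symmetric_set (cosk n X)"
proof
  fix m x assume x: "x \<in> Simp (cosk n X) m"
  show "Act (cosk n X) m m (restrict id {..m}) x = x"
  proof (rule extensionalityI[OF cosk_Act_extensional cosk_SimpD(1)[OF x]])
    fix i assume "i \<in> cosk_index n m"
    then show "Act (cosk n X) m m (restrict id {..m}) x i = x i"
      by (cases i) (auto simp: cosk_Act cosk_index_def compose_id_left)
  qed
next
  fix \<beta> k m \<alpha> p x assume *: "\<beta> \<in> maps k m" "\<alpha> \<in> maps m p" "x \<in> Simp (cosk n X) p"
  show "Act (cosk n X) k p (compose {..k} \<alpha> \<beta>) x =
      Act (cosk n X) k m \<beta> (Act (cosk n X) m p \<alpha> x)"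
  proof (rule extensionalityI[OF cosk_Act_extensional cosk_Act_extensional])
    fix i assume "i \<in> cosk_index n k"
    then show "Act (cosk n X) k p (compose {..k} \<alpha> \<beta>) x i =
        Act (cosk n X) k m \<beta> (Act (cosk n X) m p \<alpha> x) i"
      using *(1)
      by (cases i) (auto simp: cosk_Act cosk_index_def maps_compose maps_compose_assoc)
  qed
qed (rule cosk_Act_closed)

lemma nat_transI:
  assumes "f \<in> extensional L" "\<And>k. k \<in> L \<Longrightarrow> f k \<in> extensional (Simp X k)"
    and "\<And>k x. k \<in> L \<Longrightarrow> x \<in> Simp X k \<Longrightarrow> f k x \<in> Simp Y k"
    and "\<And>k l \<alpha> x. k \<in> L \<Longrightarrow> l \<in> L \<Longrightarrow> \<alpha> \<in> maps k l \<Longrightarrow> x \<in> Simp X l \<Longrightarrow>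
      f k (Act X k l \<alpha> x) = Act Y k l \<alpha> (f l x)"
  shows "f \<in> nat_trans L X Y"
  using assms by (auto simp: nat_trans_def PiE_iff)

lemma nat_transD:
  assumes "f \<in> nat_trans L X Y"
  shows "f \<in> extensional L" "\<And>k. k \<in> L \<Longrightarrow> f k \<in> extensional (Simp X k)"
    and "\<And>k x. k \<in> L \<Longrightarrow> x \<in> Simp X k \<Longrightarrow> f k x \<in> Simp Y k"
    and "\<And>k l \<alpha> x. k \<in> L \<Longrightarrow> l \<in> L \<Longrightarrow> \<alpha> \<in> maps k l \<Longrightarrow> x \<in> Simp X l \<Longrightarrow>
      f k (Act X k l \<alpha> x) = Act Y k l \<alpha> (f l x)"
  using assms by (auto simp: nat_trans_def PiE_iff)

lemma cosk_transpose_apply: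
  "y \<in> Simp Y m \<Longrightarrow> k \<le> n \<Longrightarrow> \<alpha> \<in> maps k m \<Longrightarrow>
     cosk_transpose n Y f m y (k, \<alpha>) = f k (Act Y k m \<alpha> y)"
  by (simp add: cosk_transpose_def cosk_index_def)

lemma cosk_transpose_nat_trans:
  assumes "symmetric_set Y" and f: "f \<in> nat_trans {..n} Y X"
  shows "cosk_transpose n Y f \<in> nat_trans UNIV Y (cosk n X)"
proof -
  interpret Y: symmetric_set Y by fact
  have simp: "cosk_transpose n Y f m y \<in> Simp (cosk n X) m" if y: "y \<in> Simp Y m" for m y
  proof (rule cosk_SimpI)
    show "cosk_transpose n Y f m y \<in> extensional (cosk_index n m)"
      using y by (simp add: cosk_transpose_def)
  next
    fix k \<alpha> assume "k \<le> n" "\<alpha> \<in> maps k m"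
    then show "cosk_transpose n Y f m y (k, \<alpha>) \<in> Simp X k"
      using y nat_transD(3)[OF f] by (simp add: cosk_transpose_apply Y.Act_closed)
  next
    fix k l \<alpha> \<beta> assume "k \<le> n" "l \<le> n" "\<beta> \<in> maps k l" "\<alpha> \<in> maps l m"
    then show "cosk_transpose n Y f m y (k, compose {..k} \<alpha> \<beta>) =
        Act X k l \<beta> (cosk_transpose n Y f m y (l, \<alpha>))"
      using y nat_transD(4)[OF f]
      by (simp add: cosk_transpose_apply maps_compose Y.Act_comp Y.Act_closed)
  qed
  show ?thesis
  proof (rule nat_transI)
    fix k l \<alpha> x assume *: "\<alpha> \<in> maps k l" "x \<in> Simp Y l"
    show "cosk_transpose n Y f k (Act Y k l \<alpha> x) =
        Act (cosk n X) k l \<alpha> (cosk_transpose n Y f l x)"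
    proof (rule extensionalityI[OF cosk_SimpD(1)[OF simp] cosk_Act_extensional])
      show "Act Y k l \<alpha> x \<in> Simp Y k" using * by (rule Y.Act_closed)
    next
      fix i assume "i \<in> cosk_index n k"
      then show "cosk_transpose n Y f k (Act Y k l \<alpha> x) i =
          Act (cosk n X) k l \<alpha> (cosk_transpose n Y f l x) i"
        using *
        by (cases i) (auto simp: cosk_Act cosk_transpose_apply Y.Act_closed Y.Act_comp
            maps_compose cosk_index_def)
    qed
  qed (use simp in \<open>auto simp: cosk_transpose_def\<close>)
qed

theorem bij_betw_cosk_transpose:
  assumes "symmetric_set Y" "symmetric_set X"
  shows "bij_betw (cosk_transpose n Y) (nat_trans {..n} Y X) (nat_trans UNIV Y (cosk n X))"
proof -
  interpret Y: symmetric_set Y by fact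
  interpret X: symmetric_set X by fact
  interpret C: symmetric_set "cosk n X" by (rule symmetric_set_cosk)
  define inv where
    "inv g = (\<lambda>k\<in>{..n}. \<lambda>y\<in>Simp Y k. g k y (k, restrict id {..k}))"
    for g :: "nat \<Rightarrow> 'a \<Rightarrow> nat \<times> (nat \<Rightarrow> nat) \<Rightarrow> 'b"
  show ?thesis
  proof (rule bij_betw_byWitness[where f' = inv])
    show "\<forall>f\<in>nat_trans {..n} Y X. inv (cosk_transpose n Y f) = f"
    proof
      fix f assume f: "f \<in> nat_trans {..n} Y X"
      show "inv (cosk_transpose n Y f) = f"
      proof (rule extensionalityI[OF _ nat_transD(1)[OF f]])
        fix k assume k: "k \<in> {..n}"
        show "inv (cosk_transpose n Y f) k = f k"
          by (rule extensionalityI[OF _ nat_transD(2)[OF f k]])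
            (use k in \<open>simp_all add: inv_def cosk_transpose_apply maps_id Y.Act_id\<close>)
      qed (simp add: inv_def)
    qed
  next
    show "\<forall>g\<in>nat_trans UNIV Y (cosk n X). cosk_transpose n Y (inv g) = g"
    proof
      fix g assume g: "g \<in> nat_trans UNIV Y (cosk n X)"
      have "cosk_transpose n Y (inv g) m y (k, \<alpha>) = g m y (k, \<alpha>)"
        if "y \<in> Simp Y m" "k \<le> n" "\<alpha> \<in> maps k m" for m y k \<alpha>
        using that nat_transD(4)[OF g, of k m \<alpha> y]
        by (simp add: cosk_transpose_apply inv_def Y.Act_closed cosk_Act cosk_index_def
            maps_id compose_id_right)
      moreover have "cosk_transpose n Y (inv g) m y \<in> extensional (cosk_index n m)"
        if "y \<in> Simp Y m" for m y
        using that by (simp add: cosk_transpose_def)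
      ultimately have "cosk_transpose n Y (inv g) m y = g m y" if "y \<in> Simp Y m" for m y
        using that cosk_SimpD(1)[OF nat_transD(3)[OF g, of m y]]
        by (intro extensionalityI[of _ "cosk_index n m"]) (auto simp: cosk_index_def)
      moreover have "cosk_transpose n Y (inv g) m \<in> extensional (Simp Y m)" for m
        by (simp add: cosk_transpose_def)
      ultimately have "cosk_transpose n Y (inv g) m = g m" for m
        using nat_transD(2)[OF g, of m] by (intro extensionalityI[of _ "Simp Y m"]) auto
      then show "cosk_transpose n Y (inv g) = g" by (rule ext)
    qed
  next
    show "cosk_transpose n Y ` nat_trans {..n} Y X \<subseteq> nat_trans UNIV Y (cosk n X)"
      using cosk_transpose_nat_trans[OF assms(1)] by blast
  next
    have "inv g \<in> nat_trans {..n} Y X" if g: "g \<in> nat_trans UNIV Y (cosk n X)" for g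
    proof (rule nat_transI)
      fix k x assume "k \<in> {..n}" "x \<in> Simp Y k"
      then show "inv g k x \<in> Simp X k"
        using cosk_SimpD(2)[OF nat_transD(3)[OF g, of k x]] maps_id by (simp add: inv_def)
    next
      fix k l \<alpha> x assume *: "k \<in> {..n}" "l \<in> {..n}" "\<alpha> \<in> maps k l" "x \<in> Simp Y l"
      have "g k (Act Y k l \<alpha> x) (k, restrict id {..k}) = g l x (k, \<alpha>)"
        using * nat_transD(4)[OF g, of k l \<alpha> x]
        by (simp add: cosk_Act cosk_index_def maps_id compose_id_right)
      also have "\<dots> = Act X k l \<alpha> (g l x (l, restrict id {..l}))"
        using * cosk_SimpD(3)[OF nat_transD(3)[OF g, of l x], of k l \<alpha> "restrict id {..l}"]
        by (simp add: maps_id compose_id_left)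
      finally show "inv g k (Act Y k l \<alpha> x) = Act X k l \<alpha> (inv g l x)"
        using * by (simp add: inv_def Y.Act_closed)
    qed (auto simp: inv_def)
    then show "inv ` nat_trans UNIV Y (cosk n X) \<subseteq> nat_trans {..n} Y X" by blast
  qed
qed

lemma cosk_unit_eq_transpose:
  assumes "symmetric_set X"
  shows "cosk_unit n X = cosk_transpose n X (\<lambda>k\<in>{..n}. \<lambda>x\<in>Simp X k. x)"
  using symmetric_set.Act_closed[OF assms]
  by (force simp: cosk_unit_def cosk_transpose_def cosk_index_def restrict_def fun_eq_iff)

end

theory Submission
  imports Defs
begin

text \<open>
  A simplex of \<open>cosk\<^sub>2 X\<close> is determined by its edges out of the vertex \<open>0\<close>: an edge \<open>ij\<close> lies in
  the triangle \<open>0ij\<close>, which \<open>\<B>\<^sub>2\<close> determines, and a triangle is determined by its edges.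
  Surjectivity of \<open>X \<rightarrow> cosk\<^sub>2 X\<close> in degree \<open>n \<ge> 3\<close> follows by induction: by the induction
  hypothesis the faces \<open>d\<^sub>n\<^sub>-\<^sub>2, d\<^sub>n\<^sub>-\<^sub>1, d\<^sub>n\<close> of a simplex of \<open>cosk\<^sub>2 X\<close> lift to \<open>X\<close>, so the degree
  condition provides a simplex of \<open>X\<close> with the same edges out of \<open>0\<close>.
\<close>

section \<open>Edges and triangles of \<open>[n]\<close>\<close>

lemma eps_in_maps: "i \<le> n \<Longrightarrow> j \<le> n \<Longrightarrow> eps i j \<in> maps 1 n"
  by (auto simp: eps_def maps_def)

lemma compose_eps: "compose {..1} \<alpha> (eps i j) = eps (\<alpha> i) (\<alpha> j)"
  by (rule ext) (auto simp: eps_def compose_def)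

definition tri :: "nat \<Rightarrow> nat \<Rightarrow> nat \<Rightarrow> nat \<Rightarrow> nat" where
  "tri i j k = (\<lambda>t\<in>{..2}. if t = 0 then i else if t = 1 then j else k)"

lemma tri_in_maps: "i \<le> n \<Longrightarrow> j \<le> n \<Longrightarrow> k \<le> n \<Longrightarrow> tri i j k \<in> maps 2 n"
  by (auto simp: tri_def maps_def)

lemma tri_simps [simp]: "tri i j k 0 = i" "tri i j k (Suc 0) = j" "tri i j k 2 = k"
  by (simp_all add: tri_def)

lemma maps_eqI:
  assumes "\<alpha> \<in> maps m n" "\<beta> \<in> maps m n'" "\<And>i. i \<le> m \<Longrightarrow> \<alpha> i = \<beta> i"
  shows "\<alpha> = \<beta>"
  using assms unfolding maps_def by (auto intro: extensionalityI simp: PiE_iff)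

context symmetric_set
begin

section \<open>Triangles in a spiny symmetric set\<close>

lemma Act_Act_eps:
  assumes "\<alpha> \<in> maps m n" "x \<in> Simp X n" "i \<le> m" "j \<le> m"
  shows "Act X 1 m (eps i j) (Act X m n \<alpha> x) = Act X 1 n (eps (\<alpha> i) (\<alpha> j)) x"
  using Act_comp[OF eps_in_maps[OF assms(3,4)] assms(1,2)] by (simp only: compose_eps)

lemma triangle_eqI_segal:
  assumes "spiny X" "x \<in> Simp X 2" "y \<in> Simp X 2"
    and "Act X 1 2 (eps 0 1) x = Act X 1 2 (eps 0 1) y"
    and "Act X 1 2 (eps 1 2) x = Act X 1 2 (eps 1 2) y"
  shows "x = y"
proof -
  have "segal X 2 x = segal X 2 y"
    using assms(4,5) by (simp add: segal_def upt_rec numeral_2_eq_2)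
  moreover have "inj_on (segal X 2) (Simp X 2)"
    using assms(1) by (simp add: spiny_def)
  ultimately show ?thesis
    using assms(2,3) by (simp add: inj_on_def)
qed

text \<open>Transposing the vertices \<open>0\<close> and \<open>1\<close> turns the Bousfield--Segal map into the Segal map.\<close>

lemma triangle_eqI_bousfield:
  assumes "spiny X" and x: "x \<in> Simp X 2" and y: "y \<in> Simp X 2"
    and 01: "Act X 1 2 (eps 0 1) x = Act X 1 2 (eps 0 1) y"
    and 02: "Act X 1 2 (eps 0 2) x = Act X 1 2 (eps 0 2) y"
  shows "x = y"
proof -
  let ?t = "tri 1 0 2"
  have t: "?t \<in> maps 2 2" by (simp add: tri_in_maps)
  \<comment> \<open>Non-monotone maps enter here: the edge \<open>10\<close> is the edge
    \<open>01\<close> pulled back along the swap of \<open>[1]\<close>.\<close>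
  have flip: "Act X 1 2 (eps 1 0) z = Act X 1 1 (eps 1 0) (Act X 1 2 (eps 0 1) z)"
    if "z \<in> Simp X 2" for z
    using Act_Act_eps[OF eps_in_maps[of 0 2 1] that, of 1 0] by (simp add: eps_def)
  \<comment> \<open>\<open>?t\<close> sends the Segal edges \<open>01\<close> and \<open>12\<close>
    to \<open>10\<close> and \<open>02\<close>.\<close>
  have "Act X 2 2 ?t x = Act X 2 2 ?t y"
  proof (rule triangle_eqI_segal)
    show "Act X 1 2 (eps 0 1) (Act X 2 2 ?t x) = Act X 1 2 (eps 0 1) (Act X 2 2 ?t y)"
      using Act_Act_eps[OF t x, of 0 1] Act_Act_eps[OF t y, of 0 1] flip[OF x] flip[OF y] 01
      by simp
    show "Act X 1 2 (eps 1 2) (Act X 2 2 ?t x) = Act X 1 2 (eps 1 2) (Act X 2 2 ?t y)"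
      using Act_Act_eps[OF t x, of 1 2] Act_Act_eps[OF t y, of 1 2] 02 by simp
  qed (use assms Act_closed t in auto)
  \<comment> \<open>\<open>?t\<close> is an involution, so its action is injective.\<close>
  moreover have "Act X 2 2 ?t (Act X 2 2 ?t z) = z" if "z \<in> Simp X 2" for z
  proof -
    have "compose {..2} ?t ?t = restrict id {..2}"
      by (rule ext) (auto simp: compose_def tri_def)
    then show ?thesis
      using Act_comp[OF t t that] Act_id[OF that] by simp
  qed
  ultimately show ?thesis using x y by metis
qed

section \<open>Simplices of the \<open>2\<close>-coskeleton\<close>

lemma cosk_eqI:
  assumes "spiny X" "1 \<le> n"
    and s: "s \<in> Simp (cosk 2 X) n" and t: "t \<in> Simp (cosk 2 X) n"
    and star: "\<And>i. 1 \<le> i \<Longrightarrow> i \<le> n \<Longrightarrow> s (1, eps 0 i) = t (1, eps 0 i)"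
  shows "s = t"
proof -
  have face: "u (1, eps (\<alpha> i) (\<alpha> j)) = Act X 1 k (eps i j) (u (k, \<alpha>))"
    if "u \<in> Simp (cosk 2 X) n" "k \<le> 2" "\<alpha> \<in> maps k n" "i \<le> k" "j \<le> k" for u k \<alpha> i j
    using cosk_SimpD(3)[OF that(1) _ that(2) eps_in_maps[OF that(4,5)] that(3)]
    by (simp only: compose_eps)
  \<comment> \<open>\<open>star\<close> omits the degenerate edge \<open>00\<close>. It is
    \<open>01\<close> pulled back along the constant map at \<open>0\<close>, and \<open>01\<close>
    exists because \<open>1 \<le> n\<close>.\<close>
  have star0: "s (1, eps 0 i) = t (1, eps 0 i)" if "i \<le> n" for i
  proof (cases "i = 0")
    case True
    have "eps 0 0 = eps (eps 0 1 0) (eps 0 1 0)" by (simp add: eps_def)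
    then show ?thesis
      using face[OF s, of 1 "eps 0 1" 0 0] face[OF t, of 1 "eps 0 1" 0 0] star[of 1]
        assms(2) eps_in_maps[of 0 n 1] True
      by simp
  qed (use star that in simp)
  have edge: "s (1, eps i j) = t (1, eps i j)" if "i \<le> n" "j \<le> n" for i j
  proof -
    \<comment> \<open>This triangle may be degenerate: \<open>i\<close> or \<open>j\<close> can be
      \<open>0\<close>, hence \<open>star0\<close> below.\<close>
    have tri: "tri 0 i j \<in> maps 2 n" using that by (simp add: tri_in_maps)
    have edges: "Act X 1 2 (eps 0 1) (u (2, tri 0 i j)) = u (1, eps 0 i)"
        "Act X 1 2 (eps 0 2) (u (2, tri 0 i j)) = u (1, eps 0 j)"
        "Act X 1 2 (eps 1 2) (u (2, tri 0 i j)) = u (1, eps i j)"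
      if u: "u \<in> Simp (cosk 2 X) n" for u
      using face[OF u _ tri, of 0 1] face[OF u _ tri, of 0 2] face[OF u _ tri, of 1 2]
      by simp_all
    have "s (2, tri 0 i j) = t (2, tri 0 i j)"
    proof (rule triangle_eqI_bousfield[OF assms(1)])
      show "s (2, tri 0 i j) \<in> Simp X 2" "t (2, tri 0 i j) \<in> Simp X 2"
        using cosk_SimpD(2)[OF s _ tri] cosk_SimpD(2)[OF t _ tri] by simp_all
    qed (simp_all only: edges[OF s] edges[OF t] star0[OF that(1)] star0[OF that(2)])
    then show ?thesis
      using edges(3)[OF s] edges(3)[OF t] by simp
  qed
  show ?thesis
  proof (rule extensionalityI[OF cosk_SimpD(1)[OF s] cosk_SimpD(1)[OF t]])
    fix p assume "p \<in> cosk_index 2 n"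
    then obtain k \<alpha> where p: "p = (k, \<alpha>)" and k: "k \<le> 2" and \<alpha>: "\<alpha> \<in> maps k n"
      by (auto simp: cosk_index_def)
    have bound: "\<alpha> i \<le> n" if "i \<le> k" for i
      using \<alpha> that by (auto simp: maps_def)
    consider "k = 0" | "k = 1" | "k = 2" using k by linarith
    then have "s (k, \<alpha>) = t (k, \<alpha>)"
    proof cases
      case 1
      \<comment> \<open>A vertex is the source of the degenerate edge on it, so \<open>edge\<close>
        settles degree \<open>0\<close>.\<close>
      let ?v = "\<lambda>t\<in>{..0::nat}. 0::nat"
      have v: "?v \<in> maps 0 1" by (auto simp: maps_def)
      have e: "eps (\<alpha> 0) (\<alpha> 0) \<in> maps 1 n" by (intro eps_in_maps bound) simp_all
      have "compose {..0} (eps (\<alpha> 0) (\<alpha> 0)) ?v = \<alpha>"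
        by (rule maps_eqI[OF maps_compose[OF v e]])
          (use \<alpha> 1 in \<open>auto simp: eps_def compose_def\<close>)
      then have vertex: "u (0, \<alpha>) = Act X 0 1 ?v (u (1, eps (\<alpha> 0) (\<alpha> 0)))"
        if "u \<in> Simp (cosk 2 X) n" for u
        using cosk_SimpD(3)[OF that _ _ v e] by simp
      show ?thesis
        using vertex[OF s] vertex[OF t] edge bound[of 0] 1 by simp
    next
      case 2
      then have \<alpha>1: "\<alpha> \<in> maps 1 n" using \<alpha> by simp
      have "eps (\<alpha> 0) (\<alpha> 1) = \<alpha>"
        by (rule maps_eqI[OF eps_in_maps[OF bound bound] \<alpha>1])
          (use 2 in \<open>auto simp: eps_def le_Suc_eq\<close>)
      then show ?thesis
        using edge[OF bound bound, of 0 1] 2 by simp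
    next
      case 3
      then have \<alpha>2: "\<alpha> \<in> maps 2 n" using \<alpha> by simp
      have "s (2, \<alpha>) = t (2, \<alpha>)"
      proof (rule triangle_eqI_segal[OF assms(1)])
        show "Act X 1 2 (eps 0 1) (s (2, \<alpha>)) = Act X 1 2 (eps 0 1) (t (2, \<alpha>))"
          using face[OF s _ \<alpha>2, of 0 1] face[OF t _ \<alpha>2, of 0 1] edge bound 3 by simp
        show "Act X 1 2 (eps 1 2) (s (2, \<alpha>)) = Act X 1 2 (eps 1 2) (t (2, \<alpha>))"
          using face[OF s _ \<alpha>2, of 1 2] face[OF t _ \<alpha>2, of 1 2] edge bound 3 by simp
      qed (use cosk_SimpD(2)[OF s _ \<alpha>2] cosk_SimpD(2)[OF t _ \<alpha>2] in simp_all)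
      then show ?thesis using 3 by simp
    qed
    then show "s p = t p" using p by simp
  qed
qed

section \<open>The canonical map: naturality and injectivity\<close>

lemma cosk_unit_apply:
  "x \<in> Simp X m \<Longrightarrow> k \<le> n \<Longrightarrow> \<alpha> \<in> maps k m \<Longrightarrow> cosk_unit n X m x (k, \<alpha>) = Act X k m \<alpha> x"
  by (simp add: cosk_unit_def cosk_index_def)

lemma cosk_unit_nat_trans: "cosk_unit n X \<in> nat_trans UNIV X (cosk n X)"
proof -
  have "(\<lambda>k\<in>{..n}. \<lambda>x\<in>Simp X k. x) \<in> nat_trans {..n} X X"
    by (rule nat_transI) (auto simp: Act_closed)
  then show ?thesis
    using cosk_transpose_nat_trans[OF symmetric_set_axioms]
      cosk_unit_eq_transpose[OF symmetric_set_axioms] by metis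
qed

lemma cosk_unit_closed: "x \<in> Simp X m \<Longrightarrow> cosk_unit n X m x \<in> Simp (cosk n X) m"
  using nat_transD(3)[OF cosk_unit_nat_trans] by simp

text \<open>Since \<open>1 \<le> n\<close>, the spine edges are among the components of the image,
  and spininess applies. In degree \<open>0\<close> the component at the identity of
  \<open>[0]\<close> is the simplex itself.\<close>

lemma inj_on_cosk_unit:
  assumes "spiny X" "1 \<le> n"
  shows "inj_on (cosk_unit n X m) (Simp X m)"
proof (rule inj_onI)
  fix x y assume x: "x \<in> Simp X m" and y: "y \<in> Simp X m"
    and eq: "cosk_unit n X m x = cosk_unit n X m y"
  have act: "Act X k m \<alpha> x = Act X k m \<alpha> y" if "k \<le> n" "\<alpha> \<in> maps k m" for k \<alpha>
    using cosk_unit_apply[OF x that] cosk_unit_apply[OF y that] eq by simp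
  show "x = y"
  proof (cases "m = 0")
    case True
    then show ?thesis
      using act[of 0 "restrict id {..0}"] maps_id[of 0] Act_id[of x 0] Act_id[of y 0] x y by simp
  next
    case False
    have "segal X m x = segal X m y"
      unfolding segal_def using assms(2)
      by (intro map_cong refl act eps_in_maps) auto
    moreover have "inj_on (segal X m) (Simp X m)"
      using False assms(1) by (simp add: spiny_def)
    ultimately show ?thesis
      using x y by (simp add: inj_on_def)
  qed
qed

section \<open>Surjectivity of the canonical map\<close>

text \<open>A Yoneda argument: for \<open>m \<le> n\<close> the identity of \<open>[m]\<close> is an
  index, and compatibility recovers the whole family from the component there.\<close>

lemma cosk_unit_surj_low:
  assumes s: "s \<in> Simp (cosk n X) m" and "m \<le> n"
  shows "s \<in> cosk_unit n X m ` Simp X m"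
proof
  let ?x = "s (m, restrict id {..m})"
  show x: "?x \<in> Simp X m"
    using cosk_SimpD(2)[OF s \<open>m \<le> n\<close> maps_id] .
  show "s = cosk_unit n X m ?x"
  proof (rule extensionalityI[OF cosk_SimpD(1)[OF s] cosk_SimpD(1)[OF cosk_unit_closed[OF x]]])
    fix p assume "p \<in> cosk_index n m"
    then obtain k \<alpha> where p: "p = (k, \<alpha>)" "k \<le> n" "\<alpha> \<in> maps k m"
      by (auto simp: cosk_index_def)
    then show "s p = cosk_unit n X m ?x p"
      using cosk_SimpD(3)[OF s p(2) \<open>m \<le> n\<close> p(3) maps_id] x
      by (simp add: cosk_unit_apply compose_id_left)
  qed
qed

text \<open>The common source is the component of \<open>s\<close> at the vertex \<open>0\<close>,
  by compatibility.\<close>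

lemma cosk_star_in_starry:
  assumes s: "s \<in> Simp (cosk n X) m" and "1 \<le> n"
  shows "map (\<lambda>i. s (1, eps 0 i)) [1..<m + 1] \<in> starry X m"
proof -
  let ?v = "\<lambda>t\<in>{..0::nat}. 0::nat"
  have v: "?v \<in> maps 0 1" by (auto simp: maps_def)
  have "source X (s (1, eps 0 i)) = s (0, ?v)" if "i \<le> m" for i
  proof -
    have "compose {..0} (eps 0 i) ?v = ?v"
      by (rule ext) (simp add: compose_def eps_def)
    then show ?thesis
      using cosk_SimpD(3)[OF s _ assms(2) v eps_in_maps[of 0 m i]] that
      by (simp add: source_def)
  qed
  moreover have "s (1, eps 0 i) \<in> Simp X 1" if "i \<le> m" for i
    using cosk_SimpD(2)[OF s assms(2) eps_in_maps] that by simp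
  ultimately show ?thesis by (auto simp: starry_def)
qed

text \<open>Deleting an entry of the star corresponds to restricting \<open>s\<close> along the
  injection that omits the vertex \<open>i\<close>. As \<open>1 \<le> i\<close>, this keeps the
  vertex \<open>0\<close>, and \<open>surj\<close> lifts the restricted simplex to
  \<open>X\<close>.\<close>

lemma face_cosk_star:
  assumes s: "s \<in> Simp (cosk n X) m" and "1 \<le> n" and i: "1 \<le> i" "i \<le> m"
    and surj: "Simp (cosk n X) (m - 1) \<subseteq> cosk_unit n X (m - 1) ` Simp X (m - 1)"
  shows "face i (map (\<lambda>j. s (1, eps 0 j)) [1..<m + 1]) \<in> bousfield X (m - 1) ` Simp X (m - 1)"
proof -
  define \<delta> where "\<delta> = (\<lambda>j\<in>{..m - 1}. if j < i then j else j + 1)"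
  have \<delta>: "\<delta> \<in> maps (m - 1) m" using i by (auto simp: \<delta>_def maps_def)
  obtain y where y: "y \<in> Simp X (m - 1)"
    and eq: "Act (cosk n X) (m - 1) m \<delta> s = cosk_unit n X (m - 1) y"
    using cosk_Act_closed[OF \<delta> s] surj by blast
  have edge: "Act X 1 (m - 1) (eps 0 j) y = s (1, eps 0 (\<delta> j))" if "j \<le> m - 1" for j
  proof -
    have e: "eps 0 j \<in> maps 1 (m - 1)" by (intro eps_in_maps that) simp
    have "\<delta> 0 = 0" using i by (simp add: \<delta>_def)
    have "Act X 1 (m - 1) (eps 0 j) y = Act (cosk n X) (m - 1) m \<delta> s (1, eps 0 j)"
      using cosk_unit_apply[OF y assms(2) e] eq by simp
    also have "\<dots> = s (1, eps 0 (\<delta> j))"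
      using e assms(2) compose_eps[of \<delta> 0 j] \<open>\<delta> 0 = 0\<close>
      by (simp add: cosk_Act cosk_index_def)
    finally show ?thesis .
  qed
  have "face i (map (\<lambda>j. s (1, eps 0 j)) [1..<m + 1]) = bousfield X (m - 1) y"
  proof (rule nth_equalityI)
    fix j assume "j < length (face i (map (\<lambda>j. s (1, eps 0 j)) [1..<m + 1]))"
    then have j: "j < m - 1" using i by (simp add: face_def)
    \<comment> \<open>List index \<open>j\<close> holds the edge to the vertex
      \<open>j + 1\<close>.\<close>
    have "\<delta> (j + 1) = (if j + 1 < i then j + 1 else j + 2)" using j by (simp add: \<delta>_def)
    moreover have "bousfield X (m - 1) y ! j = s (1, eps 0 (\<delta> (j + 1)))"
      using j edge[of "j + 1"] by (simp add: bousfield_def)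
    ultimately show "face i (map (\<lambda>j. s (1, eps 0 j)) [1..<m + 1]) ! j = bousfield X (m - 1) y ! j"
      using j i by (auto simp: face_def nth_append min_def simp del: upt_Suc)
  qed (use i in \<open>simp add: face_def bousfield_def\<close>)
  then show ?thesis using y by blast
qed

lemma cosk_unit_surj:
  assumes "spiny X" "degree_at_most 2 X"
  shows "Simp (cosk 2 X) m \<subseteq> cosk_unit 2 X m ` Simp X m"
proof (induction m)
  case 0
  show ?case using cosk_unit_surj_low[of _ 2 0] by auto
next
  case (Suc m)
  show ?case
  proof
    fix s assume s: "s \<in> Simp (cosk 2 X) (Suc m)"
    show "s \<in> cosk_unit 2 X (Suc m) ` Simp X (Suc m)"
    proof (cases "Suc m \<le> 2")
      case True
      then show ?thesis by (rule cosk_unit_surj_low[OF s])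
    next
      case False
      let ?w = "map (\<lambda>i. s (1, eps 0 i)) [1..<Suc m + 1]"
      \<comment> \<open>Here \<open>Suc m \<ge> 3\<close>, so every such \<open>i\<close> is at
        least \<open>1\<close> and the vertex \<open>0\<close> is never omitted.\<close>
      have "face i ?w \<in> bousfield X (Suc m - 1) ` Simp X (Suc m - 1)"
        if "i \<in> {Suc m - 2..Suc m}" for i
        by (rule face_cosk_star[OF s]) (use that False Suc.IH in auto)
      moreover have "?w \<in> starry X (Suc m)"
        by (rule cosk_star_in_starry[OF s]) simp
      moreover have "2 + 1 \<le> Suc m" using False by simp
      ultimately have "?w \<in> bousfield X (Suc m) ` Simp X (Suc m)"
        using assms(2) unfolding degree_at_most_def by blast
      then obtain x where x: "x \<in> Simp X (Suc m)" and w: "?w = bousfield X (Suc m) x"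
        by blast
      \<comment> \<open>So far \<open>x\<close> matches \<open>s\<close> only on the edges out of
        \<open>0\<close>; \<open>cosk_eqI\<close> extends this to all components.\<close>
      have "s = cosk_unit 2 X (Suc m) x"
      proof (rule cosk_eqI[OF assms(1) _ s cosk_unit_closed[OF x]])
        fix i assume i: "1 \<le> i" "i \<le> Suc m"
        have "s (1, eps 0 i) = Act X 1 (Suc m) (eps 0 i) x"
          using w i by (simp add: bousfield_def del: upt_Suc)
        then show "s (1, eps 0 i) = cosk_unit 2 X (Suc m) x (1, eps 0 i)"
          using cosk_unit_apply[OF x, of 1 2 "eps 0 i"] eps_in_maps[of 0 "Suc m" i] i by simp
      qed simp
      then show ?thesis using x by blast
    qed
  qed
qed

text \<open>The levelwise inverse is automatically natural: its naturality can be checked after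
  applying \<open>f k\<close>, which is injective.\<close>

lemma symset_isoI:
  assumes f: "f \<in> nat_trans UNIV X Y"
    and bij: "\<And>n. bij_betw (f n) (Simp X n) (Simp Y n)"
  shows "symset_iso X Y f"
proof -
  \<comment> \<open>The restriction makes each \<open>g n\<close> extensional, as
    \<open>nat_trans\<close> demands.\<close>
  define g where "g = (\<lambda>n. restrict (inv_into (Simp X n) (f n)) (Simp Y n))"
  have gf: "g n (f n x) = x" if "x \<in> Simp X n" for n x
    using bij[of n] that by (auto simp: g_def bij_betw_def)
  have fg: "f n (g n y) = y" if "y \<in> Simp Y n" for n y
    using bij_betw_inv_into_right[OF bij that] that by (simp add: g_def)
  have g_closed: "g n y \<in> Simp X n" if "y \<in> Simp Y n" for n y
    using bij_betw_apply[OF bij_betw_inv_into[OF bij] that] that by (simp add: g_def)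
  have "g \<in> nat_trans UNIV Y X"
  proof (rule nat_transI)
    fix k l \<alpha> y assume \<alpha>: "\<alpha> \<in> maps k l" and y: "y \<in> Simp Y l"
    have "f k (Act X k l \<alpha> (g l y)) = Act Y k l \<alpha> y"
      using nat_transD(4)[OF f _ _ \<alpha> g_closed[OF y]] fg[OF y] by simp
    then show "g k (Act Y k l \<alpha> y) = Act X k l \<alpha> (g l y)"
      using gf[OF Act_closed[OF \<alpha> g_closed[OF y]]] by simp
  qed (use g_closed in \<open>auto simp: g_def\<close>)
  with f gf fg show ?thesis
    unfolding symset_iso_def by blast
qed

end

theorem corollary6p7:
  fixes X :: "'a symset"
  assumes "symmetric_set X" and "spiny X" and "degree_at_most 2 X"
  shows "coskeletal 2 X"
proof -
  interpret symmetric_set X by fact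
  have "bij_betw (cosk_unit 2 X n) (Simp X n) (Simp (cosk 2 X) n)" for n
    using inj_on_cosk_unit[OF assms(2), of 2 n] cosk_unit_surj[OF assms(2,3), of n]
      cosk_unit_closed
    by (auto simp: bij_betw_def)
  then show ?thesis
    unfolding coskeletal_def by (intro symset_isoI cosk_unit_nat_trans)
qed

end
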